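(* For the two-bishop game graph $G(B(a,b),B_Lb_D)$ on an $a\times b$ grid: \begin{enumerate} \item If $n>1$ then $\beta(G(B(2,n),B_Lb_D))=2$. \item $\beta(G(B(3,3),B_Lb_D))=\beta(G(B(3,4),B_Lb_D))=3$. \end{enumerate}
   Context: The bishop graph $B(a,b)$ is the simple graph whose vertices are the squares of an $a\times b$ grid, two distinct squares being adjacent if and only if a bishop can move from one to the other, i.e. they lie on a common diagonal (in any diagonal direction, at any distance): squares $(i,j)\ne(i',j')$ are adjacent iff $|i-i'|=|j-j'|$. Colour the squares light and dark as on a chessboard (by the parity of $i+j$). $B_L(a,b)$ and $B_D(a,b)$ denote the subgraphs of $B(a,b)$ induced on the light and on the dark squares, respectively. $B_Lb_D$ denotes the position with one bishop on a light square and an opposing bishop on a dark square (so that they never threaten each other). The game graph $G(B(a,b),B_Lb_D)$ is taken to be the simple undirected graph $B_L(a,b)\,\square\,B_D(a,b)$ (Cartesian product). Metric dimension: for an ordered set $S=(u_1,\dots,u_k)$ of vertices of a connected simple graph $G$, the distance vector of a vertex $v$ is $(d(u_1,v),\dots,d(u_k,v))$, where $d$ is the usual graph distance. $S$ is a resolving set if distinct vertices have distinct distance vectors. The metric dimension $\beta(G)$ is the minimum cardinality of a resolving set. *)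

theory Defs
  imports "Graph_Theory.Graph_Theory"
begin

text \<open>Undirected simple graphs are symmetric loop-free digraphs without parallel arcs, as in the
  locales \<^locale>\<open>graph\<close> and \<^locale>\<open>pair_graph\<close>: each edge is a pair of opposite arcs.\<close>

section \<open>Metric dimension\<close>

text \<open>Usual graph distance: the infimum over all walks of the number of arcs. The value is infinite
  if no walk exists; in connected graphs it is always a natural number.\<close>

definition graph_dist :: "('a, 'b) pre_digraph \<Rightarrow> 'a \<Rightarrow> 'a \<Rightarrow> ereal" where
  "graph_dist G u v = wf_digraph.\<mu> G (\<lambda>_. 1) u v"

lemma (in wf_digraph) graph_dist_eq_INF_length:
  "graph_dist G u v = (INF p \<in> {p. awalk u p v}. ereal (real (length p)))"
proof -
  have "awalk_cost (\<lambda>_. 1) p = real (length p)" for p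
    by (induct p) auto
  then show ?thesis
    by (simp add: graph_dist_def \<mu>_def)
qed

definition distance_vector :: "('a, 'b) pre_digraph \<Rightarrow> 'a list \<Rightarrow> 'a \<Rightarrow> ereal list" where
  "distance_vector G S v = map (\<lambda>u. graph_dist G u v) S"

text \<open>Ordered sets of vertices are distinct lists.\<close>

definition resolving_set :: "('a, 'b) pre_digraph \<Rightarrow> 'a list \<Rightarrow> bool" where
  "resolving_set G S \<longleftrightarrow>
     distinct S \<and> set S \<subseteq> verts G \<and>
     (\<forall>v \<in> verts G. \<forall>w \<in> verts G. v \<noteq> w \<longrightarrow> distance_vector G S v \<noteq> distance_vector G S w)"

text \<open>For a finite graph the minimum exists, since an enumeration of all vertices is resolving.\<close>

definition metric_dimension :: "('a, 'b) pre_digraph \<Rightarrow> nat" where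
  "metric_dimension G = (LEAST k. \<exists>S. resolving_set G S \<and> length S = k)"

section \<open>Cartesian products\<close>

definition cartesian_product ::
    "('a, 'b) pre_digraph \<Rightarrow> ('c, 'd) pre_digraph \<Rightarrow> ('a \<times> 'c) pair_pre_digraph" where
  "cartesian_product G H =
     \<lparr> pverts = verts G \<times> verts H,
       parcs = {((u, x), (v, y)) | u x v y.
         (u \<in> verts G \<and> u = v \<and> x \<rightarrow>\<^bsub>H\<^esub> y) \<or> (u \<rightarrow>\<^bsub>G\<^esub> v \<and> x \<in> verts H \<and> x = y)} \<rparr>"

lemma pair_graph_cartesian_product:
  assumes "graph G" "graph H"
  shows "pair_graph (cartesian_product G H)"
proof -
  interpret G: graph G by fact
  interpret H: graph H by fact
  let ?P = "cartesian_product G H"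
  have sub: "parcs ?P \<subseteq> pverts ?P \<times> pverts ?P"
    by (auto simp: cartesian_product_def dest: G.adj_in_verts H.adj_in_verts)
  have fin: "finite (pverts ?P)"
    by (simp add: cartesian_product_def)
  then have "finite (parcs ?P)"
    using finite_subset[OF sub] by blast
  moreover have "sym (parcs ?P)"
    using arcs_ends_symmetric[OF G.sym_arcs] arcs_ends_symmetric[OF H.sym_arcs]
    by (auto simp: cartesian_product_def intro!: symI)
  moreover have "fst e \<noteq> snd e" if "e \<in> parcs ?P" for e
    using that by (auto simp: cartesian_product_def dest: G.adj_not_same H.adj_not_same)
  ultimately show ?thesis
    using sub fin by unfold_locales (auto simp: symmetric_def)
qed

section \<open>Bishop graphs\<close>

definition bishop_graph :: "nat \<Rightarrow> nat \<Rightarrow> (nat \<times> nat) pair_pre_digraph" where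
  "bishop_graph a b =
     \<lparr> pverts = {1..a} \<times> {1..b},
       parcs = {((i, j), (i', j')) | i j i' j'.
         (i, j) \<in> {1..a} \<times> {1..b} \<and> (i', j') \<in> {1..a} \<times> {1..b} \<and> (i, j) \<noteq> (i', j') \<and>
         \<bar>int i - int i'\<bar> = \<bar>int j - int j'\<bar>} \<rparr>"

lemma pair_graph_bishop_graph: "pair_graph (bishop_graph a b)"
proof -
  let ?B = "bishop_graph a b"
  have sub: "parcs ?B \<subseteq> pverts ?B \<times> pverts ?B"
    by (auto simp: bishop_graph_def)
  have fin: "finite (pverts ?B)"
    by (simp add: bishop_graph_def)
  then have "finite (parcs ?B)"
    using finite_subset[OF sub] by blast
  moreover have "sym (parcs ?B)"
    by (auto simp: bishop_graph_def intro!: symI)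
  moreover have "fst e \<noteq> snd e" if "e \<in> parcs ?B" for e
    using that by (auto simp: bishop_graph_def)
  ultimately show ?thesis
    using sub fin by unfold_locales (auto simp: symmetric_def)
qed

text \<open>The square \<open>(1, 1)\<close> is taken to be light. The opposite convention exchanges the two factors
  of the Cartesian product below and hence yields an isomorphic game graph.\<close>

definition light_squares :: "nat \<Rightarrow> nat \<Rightarrow> (nat \<times> nat) set" where
  "light_squares a b = {(i, j) \<in> {1..a} \<times> {1..b}. even (i + j)}"

definition dark_squares :: "nat \<Rightarrow> nat \<Rightarrow> (nat \<times> nat) set" where
  "dark_squares a b = {(i, j) \<in> {1..a} \<times> {1..b}. odd (i + j)}"

definition light_bishop_graph :: "nat \<Rightarrow> nat \<Rightarrow> (nat \<times> nat, (nat \<times> nat) \<times> (nat \<times> nat)) pre_digraph" where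
  "light_bishop_graph a b = with_proj (bishop_graph a b) \<restriction> light_squares a b"

definition dark_bishop_graph :: "nat \<Rightarrow> nat \<Rightarrow> (nat \<times> nat, (nat \<times> nat) \<times> (nat \<times> nat)) pre_digraph" where
  "dark_bishop_graph a b = with_proj (bishop_graph a b) \<restriction> dark_squares a b"

definition two_bishop_game_graph ::
    "nat \<Rightarrow> nat \<Rightarrow> ((nat \<times> nat) \<times> (nat \<times> nat)) pair_pre_digraph" where
  "two_bishop_game_graph a b =
     cartesian_product (light_bishop_graph a b) (dark_bishop_graph a b)"

lemma graph_induce_subgraph:
  assumes "graph G" and S: "S \<subseteq> verts G"
  shows "graph (G \<restriction> S)"
proof -
  interpret G: graph G by fact
  have "wf_digraph (G \<restriction> S)" by (rule G.wellformed_induce_subgraph)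
  then interpret H: wf_digraph "G \<restriction> S" .
  have "finite (verts (G \<restriction> S))" "finite (arcs (G \<restriction> S))"
    using finite_subset[OF S] by auto
  moreover have "symmetric (G \<restriction> S)"
    using G.sym_arcs unfolding symmetric_conv by fastforce
  ultimately show ?thesis
    by unfold_locales (auto simp: arc_to_ends_def dest: G.no_loops intro: G.no_multi_arcs)
qed

lemma pair_graph_two_bishop_game_graph: "pair_graph (two_bishop_game_graph a b)"
proof -
  interpret pair_graph "bishop_graph a b" by (rule pair_graph_bishop_graph)
  have "graph (with_proj (bishop_graph a b))" by unfold_locales
  then have "graph (light_bishop_graph a b)" "graph (dark_bishop_graph a b)"
    unfolding light_bishop_graph_def dark_bishop_graph_def
    by (rule graph_induce_subgraph;
        auto simp: light_squares_def dark_squares_def bishop_graph_def)+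
  then show ?thesis
    unfolding two_bishop_game_graph_def by (rule pair_graph_cartesian_product)
qed

end

theory Submission
  imports Defs
begin

text \<open>The lower bounds are degree counts. If \<open>S\<close> is resolving and \<open>u\<close> is a member of \<open>S\<close>, then every
  neighbour of \<open>u\<close> is at distance 1 from \<open>u\<close>, and its distance to each of the other members of \<open>S\<close>
  differs from that of \<open>u\<close> by at most 1, so \<open>u\<close> has at most \<open>3 ^ (|S| - 1)\<close> neighbours. All degrees
  of the game graph are at least 2 on the \<open>2 \<times> n\<close> board and at least 4 on the other two boards.
  For the upper bounds, distances in a Cartesian product add up. On the \<open>2 \<times> n\<close> board both factors
  are paths, so the game graph is a grid and two of its corners resolve it. On the other two boards
  both factors have diameter 2.\<close>

section \<open>Bishop moves\<close>

text \<open>Sums replace differences of coordinates, so the two diagonal directions are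
  natural-number equations that can be evaluated. The bounds of the board are left to the vertex
  sets.\<close>

definition bishop_move :: "nat \<times> nat \<Rightarrow> nat \<times> nat \<Rightarrow> bool" where
  "bishop_move u v \<longleftrightarrow> u \<noteq> v \<and>
     (fst u + snd u = fst v + snd v \<or> fst u + snd v = fst v + snd u)"

lemma bishop_move_iff:
  "bishop_move u v \<longleftrightarrow> u \<noteq> v \<and> \<bar>int (fst u) - int (fst v)\<bar> = \<bar>int (snd u) - int (snd v)\<bar>"
  unfolding bishop_move_def by arith

text \<open>The value 2 is a default for all distinct non-adjacent pairs; it is the true distance
  only in graphs of diameter at most 2.\<close>

definition bishop_dist :: "nat \<times> nat \<Rightarrow> nat \<times> nat \<Rightarrow> nat" where
  "bishop_dist u v = (if u = v then 0 else if bishop_move u v then 1 else 2)"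

definition diameter_two :: "(nat \<times> nat) list \<Rightarrow> bool" where
  "diameter_two L \<longleftrightarrow> (\<forall>u\<in>set L. \<forall>v\<in>set L. u = v \<or> bishop_move u v \<or>
     (\<exists>w\<in>set L. bishop_move u w \<and> bishop_move w v))"

definition min_degree_two :: "(nat \<times> nat) list \<Rightarrow> bool" where
  "min_degree_two L \<longleftrightarrow> (\<forall>u\<in>set L. \<exists>v\<in>set L. \<exists>w\<in>set L. v \<noteq> w \<and> bishop_move u v \<and> bishop_move u w)"

lemma bishop_move_sym: "bishop_move u v \<longleftrightarrow> bishop_move v u"
  unfolding bishop_move_def by auto

section \<open>Finite checks on the 3 x 4 and 3 x 3 boards\<close>

lemma bishop_dist_3_4:
  "distinct (map (\<lambda>v. map (\<lambda>u. bishop_dist (fst u) (fst v) + bishop_dist (snd u) (snd v))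
     [((1, 1), (1, 2)), ((3, 1), (2, 1)), ((3, 1), (3, 4))])
   (List.product [(1, 1), (1, 3), (2, 2), (2, 4), (3, 1), (3, 3)]
     [(1, 2), (1, 4), (2, 1), (2, 3), (3, 2), (3, 4)]))"
  by code_simp

text \<open>The light graph consists of two triangles sharing (2, 2), with (2, 4) joined to (1, 3)
  and (3, 3). Reversing the columns turns it into the dark graph.\<close>

lemma diameter_two_3_4:
  "diameter_two [(1, 1), (1, 3), (2, 2), (2, 4), (3, 1), (3, 3)]"
  "diameter_two [(1, 2), (1, 4), (2, 1), (2, 3), (3, 2), (3, 4)]"
  by code_simp+

lemma min_degree_two_3_4:
  "min_degree_two [(1, 1), (1, 3), (2, 2), (2, 4), (3, 1), (3, 3)]"
  "min_degree_two [(1, 2), (1, 4), (2, 1), (2, 3), (3, 2), (3, 4)]"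
  by code_simp+

text \<open>The light graph is two triangles sharing the centre, the dark graph a 4-cycle. The
  landmarks use a light corner from each triangle and two adjacent dark squares.\<close>

lemma bishop_dist_3_3:
  "distinct (map (\<lambda>v. map (\<lambda>u. bishop_dist (fst u) (fst v) + bishop_dist (snd u) (snd v))
     [((1, 1), (1, 2)), ((1, 1), (2, 1)), ((1, 3), (1, 2))])
   (List.product [(1, 1), (1, 3), (2, 2), (3, 1), (3, 3)]
     [(1, 2), (2, 1), (2, 3), (3, 2)]))"
  by code_simp

lemma diameter_two_3_3:
  "diameter_two [(1, 1), (1, 3), (2, 2), (3, 1), (3, 3)]"
  "diameter_two [(1, 2), (2, 1), (2, 3), (3, 2)]"
  by code_simp+

lemma min_degree_two_3_3:
  "min_degree_two [(1, 1), (1, 3), (2, 2), (3, 1), (3, 3)]"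
  "min_degree_two [(1, 2), (2, 1), (2, 3), (3, 2)]"
  by code_simp+

section \<open>Graph distances\<close>

text \<open>A local certificate that a guessed \<open>D\<close> is the graph distance: only single
  arcs are inspected, no walks. The last clause also forces connectedness.\<close>

definition graph_metric :: "('a, 'b) pre_digraph \<Rightarrow> ('a \<Rightarrow> 'a \<Rightarrow> nat) \<Rightarrow> bool" where
  "graph_metric G D \<longleftrightarrow>
     (\<forall>u \<in> verts G. D u u = 0) \<and>
     (\<forall>u \<in> verts G. \<forall>v \<in> verts G. D u v = D v u) \<and>
     (\<forall>u w. \<forall>v \<in> verts G. u \<rightarrow>\<^bsub>G\<^esub> w \<longrightarrow> D u v \<le> Suc (D w v)) \<and>
     (\<forall>u \<in> verts G. \<forall>v \<in> verts G. u \<noteq> v \<longrightarrow> (\<exists>w. u \<rightarrow>\<^bsub>G\<^esub> w \<and> D u v = Suc (D w v)))"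

lemma graph_metricD:
  assumes "graph_metric G D"
  shows "u \<in> verts G \<Longrightarrow> D u u = 0"
    and "u \<in> verts G \<Longrightarrow> v \<in> verts G \<Longrightarrow> D u v = D v u"
    and "u \<rightarrow>\<^bsub>G\<^esub> w \<Longrightarrow> v \<in> verts G \<Longrightarrow> D u v \<le> Suc (D w v)"
    and "u \<in> verts G \<Longrightarrow> v \<in> verts G \<Longrightarrow> u \<noteq> v \<Longrightarrow> \<exists>w. u \<rightarrow>\<^bsub>G\<^esub> w \<and> D u v = Suc (D w v)"
  using assms unfolding graph_metric_def by blast+

text \<open>Along a walk to \<open>v\<close> the value of \<open>D\<close> falls by at most 1 per
  arc and ends at 0, so no walk is shorter than \<open>D u v\<close>. Following arcs that decrease
  \<open>D\<close> gives a walk of exactly this length.\<close>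

lemma (in wf_digraph) graph_dist_eq_graph_metric:
  assumes D: "graph_metric G D" and u: "u \<in> verts G" and v: "v \<in> verts G"
  shows "graph_dist G u v = ereal (real (D u v))"
proof -
  have lower: "D u v \<le> length p" if "awalk u p v" for p
    using that
  proof (induct p arbitrary: u)
    case Nil
    then show ?case using graph_metricD(1)[OF D v] by (simp add: awalk_Nil_iff)
  next
    case (Cons e p)
    from Cons.prems have e: "e \<in> arcs G" "tail G e = u" "awalk (head G e) p v"
      by (auto simp: awalk_Cons_iff)
    then have "D u v \<le> Suc (D (head G e) v)"
      using graph_metricD(3)[OF D in_arcs_imp_in_arcs_ends v, of e] by simp
    with Cons.hyps[OF e(3)] show ?case by simp
  qed
  have "\<exists>p. awalk u p v \<and> length p = D u v"
    using u
  proof (induct "D u v" arbitrary: u)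
    case 0
    \<comment> \<open>For \<open>u \<noteq> v\<close> a decreasing arc would make
      \<open>D u v\<close> a successor.\<close>
    then have "u = v" using graph_metricD(4)[OF D _ v] by force
    then have "awalk u [] v \<and> length ([] :: 'b list) = D u v"
      using 0 by (simp add: awalk_Nil_iff)
    then show ?case by blast
  next
    case (Suc n)
    then have "u \<noteq> v" using graph_metricD(1)[OF D v] by force
    then obtain w where w: "u \<rightarrow>\<^bsub>G\<^esub> w" "D u v = Suc (D w v)"
      using graph_metricD(4)[OF D Suc.prems v] by blast
    then obtain e where e: "e \<in> arcs G" "tail G e = u" "head G e = w" by blast
    then obtain p where "awalk w p v" "length p = D w v"
      using Suc w by fastforce
    with e w have "awalk u (e # p) v \<and> length (e # p) = D u v"
      by (simp add: awalk_Cons_iff)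
    then show ?case by blast
  qed
  then obtain p where p: "awalk u p v" "length p = D u v" by blast
  show ?thesis
    unfolding graph_dist_eq_INF_length
  proof (rule antisym)
    show "(INF p \<in> {p. awalk u p v}. ereal (real (length p))) \<le> ereal (real (D u v))"
      using p by (intro INF_lower2[of p]) auto
    show "ereal (real (D u v)) \<le> (INF p \<in> {p. awalk u p v}. ereal (real (length p)))"
      using lower by (intro INF_greatest) auto
  qed
qed

text \<open>The embedding of the natural numbers into \<open>ereal\<close> is injective, so distance
  vectors may be compared through their natural-number entries.\<close>

lemma (in wf_digraph) resolving_set_iff_inj_on:
  assumes "graph_metric G D"
  shows "resolving_set G S \<longleftrightarrow>
    distinct S \<and> set S \<subseteq> verts G \<and> inj_on (\<lambda>v. map (\<lambda>u. D u v) S) (verts G)"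
proof (cases "set S \<subseteq> verts G")
  case True
  then have "distance_vector G S v = map (\<lambda>d. ereal (real d)) (map (\<lambda>u. D u v) S)" if "v \<in> verts G" for v
    using that graph_dist_eq_graph_metric[OF assms] by (auto simp: distance_vector_def)
  moreover have "inj (\<lambda>d. ereal (real d))" by (rule injI) simp
  ultimately have "distance_vector G S v = distance_vector G S w \<longleftrightarrow>
      map (\<lambda>u. D u v) S = map (\<lambda>u. D u w) S" if "v \<in> verts G" "w \<in> verts G" for v w
    using that by (metis inj_map_eq_map)
  then show ?thesis unfolding resolving_set_def inj_on_def by blast
qed (simp add: resolving_set_def)

section \<open>Resolving sets and the degree bound\<close>

lemma metric_dimension_eqI:
  assumes "resolving_set G S" "length S = k"
    and "\<And>T. resolving_set G T \<Longrightarrow> k \<le> length T"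
  shows "metric_dimension G = k"
  unfolding metric_dimension_def using assms by (intro Least_equality) auto

lemma (in graph) card_neighbours_le_of_resolving_set:
  assumes D: "graph_metric G D" and S: "resolving_set G S" and u: "u \<in> set S"
  shows "card {w. u \<rightarrow>\<^bsub>G\<^esub> w} \<le> 3 ^ (length S - 1)"
proof -
  have dS: "distinct S" and SG: "set S \<subseteq> verts G"
    and inj: "inj_on (\<lambda>v. map (\<lambda>u. D u v) S) (verts G)"
    using S resolving_set_iff_inj_on[OF D] by auto
  let ?T = "set S - {u}"
  \<comment> \<open>The entry at \<open>u\<close> is dropped, being 1 for every neighbour. Truncated
    subtraction can only shrink an interval, so each has at most three elements.\<close>
  let ?B = "PiE ?T (\<lambda>v. {D v u - 1 .. Suc (D v u)})"
  let ?f = "\<lambda>w. restrict (\<lambda>v. D v w) ?T"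
  have uV: "u \<in> verts G" using SG u by blast
  have one: "D u w = 1" if "u \<rightarrow>\<^bsub>G\<^esub> w" for w
  proof -
    have w: "w \<in> verts G" "u \<noteq> w" using that adj_in_verts adj_not_same by auto
    then have "D u w \<le> 1" using graph_metricD(3)[OF D that w(1)] graph_metricD(1)[OF D w(1)] by simp
    moreover have "D u w > 0" using graph_metricD(4)[OF D uV w] by force
    ultimately show ?thesis by simp
  qed
  have range: "?f ` {w. u \<rightarrow>\<^bsub>G\<^esub> w} \<subseteq> ?B"
  proof -
    have "D v u - 1 \<le> D v w \<and> D v w \<le> Suc (D v u)" if "u \<rightarrow>\<^bsub>G\<^esub> w" "v \<in> set S" for v w
    proof -
      have v: "v \<in> verts G" and w: "w \<in> verts G" using that SG adj_in_verts by auto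
      \<comment> \<open>The arc in one direction bounds \<open>D v w\<close> from below, the
        opposite arc bounds it from above.\<close>
      have "w \<rightarrow>\<^bsub>G\<^esub> u" using that(1) arcs_ends_symmetric[OF sym_arcs] by blast
      then show ?thesis
        using graph_metricD(3)[OF D that(1) v] graph_metricD(3)[OF D _ v, of w u]
          graph_metricD(2)[OF D uV v] graph_metricD(2)[OF D w v] by simp
    qed
    then show ?thesis by (intro image_subsetI) (simp add: restrict_PiE_iff)
  qed
  have "inj_on ?f {w. u \<rightarrow>\<^bsub>G\<^esub> w}"
  proof (rule inj_onI)
    fix x y assume xy: "x \<in> {w. u \<rightarrow>\<^bsub>G\<^esub> w}" "y \<in> {w. u \<rightarrow>\<^bsub>G\<^esub> w}" and eq: "?f x = ?f y"
    have "D v x = D v y" if "v \<in> set S" for v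
      using fun_cong[OF eq, of v] that one xy by (cases "v = u") auto
    then show "x = y" using inj_onD[OF inj, of x y] xy adj_in_verts by auto
  qed
  moreover have "finite ?B" by (intro finite_PiE) auto
  ultimately have "card {w. u \<rightarrow>\<^bsub>G\<^esub> w} \<le> card ?B"
    using range card_inj_on_le by blast
  also have "\<dots> = (\<Prod>v\<in>?T. card {D v u - 1 .. Suc (D v u)})" by (simp add: card_PiE)
  also have "\<dots> \<le> (\<Prod>v\<in>?T. 3)" by (intro prod_mono) auto
  also have "\<dots> = 3 ^ (length S - 1)"
    using u by (simp add: distinct_card[OF dS])
  finally show ?thesis .
qed

text \<open>The degree bound at a member of \<open>S\<close> gives
  \<open>3 ^ k < 3 ^ (length S - 1)\<close>, and the strict inequality of exponents yields the
  offset 2.\<close>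

lemma (in graph) length_resolving_set_ge:
  assumes D: "graph_metric G D" and S: "resolving_set G S" and "verts G \<noteq> {}"
    and deg: "\<And>u. u \<in> verts G \<Longrightarrow> 3 ^ k < card {w. u \<rightarrow>\<^bsub>G\<^esub> w}"
  shows "k + 2 \<le> length S"
proof (cases S)
  \<comment> \<open>Here there is no member whose neighbours could be counted; instead, two adjacent
    vertices share the empty distance vector.\<close>
  case Nil
  from \<open>verts G \<noteq> {}\<close> obtain u where u: "u \<in> verts G" by blast
  have "{w. u \<rightarrow>\<^bsub>G\<^esub> w} \<noteq> {}" using deg[OF u] by force
  then obtain w where "u \<rightarrow>\<^bsub>G\<^esub> w" by blast
  then have "w \<in> verts G" "u \<noteq> w" using adj_in_verts adj_not_same by auto
  with u S Nil show ?thesis by (auto simp: resolving_set_def distance_vector_def)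
next
  case (Cons u S')
  then have "u \<in> set S" "u \<in> verts G" using S by (auto simp: resolving_set_def)
  then have "(3::nat) ^ k < 3 ^ (length S - 1)"
    using deg card_neighbours_le_of_resolving_set[OF D S] less_le_trans by blast
  then have "k < length S - 1" by (rule power_less_imp_less_exp[rotated]) simp
  then show ?thesis by simp
qed

section \<open>Cartesian products\<close>

lemma verts_cartesian_product:
  "verts (with_proj (cartesian_product G H)) = verts G \<times> verts H"
  by (simp add: cartesian_product_def)

lemma dominates_cartesian_product_iff:
  "(u, x) \<rightarrow>\<^bsub>with_proj (cartesian_product G H)\<^esub> (v, y) \<longleftrightarrow>
     u \<in> verts G \<and> u = v \<and> x \<rightarrow>\<^bsub>H\<^esub> y \<or> u \<rightarrow>\<^bsub>G\<^esub> v \<and> x \<in> verts H \<and> x = y"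
  by (auto simp: cartesian_product_def)

text \<open>Each arc of the product moves in one factor only, so just one summand changes, and it
  changes as in that factor.\<close>

lemma graph_metric_cartesian_product:
  assumes D: "graph_metric G D" and E: "graph_metric H E"
  shows "graph_metric (with_proj (cartesian_product G H)) (\<lambda>p q. D (fst p) (fst q) + E (snd p) (snd q))"
  unfolding graph_metric_def verts_cartesian_product
proof (intro conjI ballI allI impI)
  fix p q assume p: "p \<in> verts G \<times> verts H" and q: "q \<in> verts G \<times> verts H" and "p \<noteq> q"
  obtain u x v y where [simp]: "p = (u, x)" "q = (v, y)" by fastforce
  show "\<exists>w. p \<rightarrow>\<^bsub>with_proj (cartesian_product G H)\<^esub> w \<and>
      D (fst p) (fst q) + E (snd p) (snd q) = Suc (D (fst w) (fst q) + E (snd w) (snd q))"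
  \<comment> \<open>The decreasing arc is taken in the first factor if the first coordinates differ,
    and in the second otherwise.\<close>
  proof (cases "u = v")
    case True
    then obtain z where "x \<rightarrow>\<^bsub>H\<^esub> z" "E x y = Suc (E z y)"
      using graph_metricD(4)[OF E] p q \<open>p \<noteq> q\<close> by force
    with True p show ?thesis
      by (intro exI[of _ "(u, z)"]) (simp add: dominates_cartesian_product_iff del: with_proj_simps)
  next
    case False
    then obtain z where "u \<rightarrow>\<^bsub>G\<^esub> z" "D u v = Suc (D z v)"
      using graph_metricD(4)[OF D] p q by force
    with p show ?thesis
      by (intro exI[of _ "(z, x)"]) (simp add: dominates_cartesian_product_iff del: with_proj_simps)
  qed
next
  fix p w q
  assume "q \<in> verts G \<times> verts H" "p \<rightarrow>\<^bsub>with_proj (cartesian_product G H)\<^esub> w"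
  then show "D (fst p) (fst q) + E (snd p) (snd q) \<le> Suc (D (fst w) (fst q) + E (snd w) (snd q))"
    using graph_metricD(3)[OF D] graph_metricD(3)[OF E]
    by (cases p; cases w; cases q)
      (auto simp: dominates_cartesian_product_iff simp del: with_proj_simps)
qed (use graph_metricD(1,2)[OF D] graph_metricD(1,2)[OF E] in auto)

text \<open>The neighbours split into those reached in the first factor and those reached in the
  second; the two sets are disjoint because \<open>G\<close> has no loops.\<close>

lemma card_neighbours_cartesian_product:
  assumes "graph G" "graph H" "u \<in> verts G" "x \<in> verts H"
  shows "card {w. (u, x) \<rightarrow>\<^bsub>with_proj (cartesian_product G H)\<^esub> w} =
    card {v. u \<rightarrow>\<^bsub>G\<^esub> v} + card {y. x \<rightarrow>\<^bsub>H\<^esub> y}"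
proof -
  interpret G: graph G by fact
  interpret H: graph H by fact
  have fin: "finite {v. u \<rightarrow>\<^bsub>G\<^esub> v}" "finite {y. x \<rightarrow>\<^bsub>H\<^esub> y}"
    by (auto intro: finite_subset[OF _ G.finite_verts] finite_subset[OF _ H.finite_verts]
        dest: G.adj_in_verts H.adj_in_verts)
  have "{w. (u, x) \<rightarrow>\<^bsub>with_proj (cartesian_product G H)\<^esub> w} =
      {v. u \<rightarrow>\<^bsub>G\<^esub> v} \<times> {x} \<union> {u} \<times> {y. x \<rightarrow>\<^bsub>H\<^esub> y}"
    using assms by (auto simp: dominates_cartesian_product_iff simp del: with_proj_simps)
  moreover have "({v. u \<rightarrow>\<^bsub>G\<^esub> v} \<times> {x}) \<inter> ({u} \<times> {y. x \<rightarrow>\<^bsub>H\<^esub> y}) = {}"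
    by (auto dest: G.adj_not_same)
  ultimately show ?thesis
    using fin by (simp add: card_Un_disjoint)
qed

section \<open>Bishop graphs\<close>

lemma verts_bishop_graphs:
  "verts (light_bishop_graph a b) = light_squares a b"
  "verts (dark_bishop_graph a b) = dark_squares a b"
  by (simp_all add: light_bishop_graph_def dark_bishop_graph_def)

lemma dominates_induce_subgraph_iff:
  "u \<rightarrow>\<^bsub>G \<restriction> S\<^esub> v \<longleftrightarrow> u \<rightarrow>\<^bsub>G\<^esub> v \<and> u \<in> S \<and> v \<in> S"
  by (auto simp: arcs_ends_conv)

lemma bishop_squares_subset:
  "light_squares a b \<subseteq> {1..a} \<times> {1..b}" "dark_squares a b \<subseteq> {1..a} \<times> {1..b}"
  unfolding light_squares_def dark_squares_def by blast+

lemma pverts_bishop_graph: "pverts (bishop_graph a b) = {1..a} \<times> {1..b}"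
  by (simp add: bishop_graph_def)

lemma parcs_bishop_graph_iff:
  "(u, v) \<in> parcs (bishop_graph a b) \<longleftrightarrow>
     u \<in> {1..a} \<times> {1..b} \<and> v \<in> {1..a} \<times> {1..b} \<and> bishop_move u v"
  by (cases u; cases v) (simp add: bishop_graph_def bishop_move_iff)

lemma dominates_bishop_graphs_iff:
  "u \<rightarrow>\<^bsub>light_bishop_graph a b\<^esub> v \<longleftrightarrow> u \<in> light_squares a b \<and> v \<in> light_squares a b \<and> bishop_move u v"
  "u \<rightarrow>\<^bsub>dark_bishop_graph a b\<^esub> v \<longleftrightarrow> u \<in> dark_squares a b \<and> v \<in> dark_squares a b \<and> bishop_move u v"
  using bishop_squares_subset[of a b]
  unfolding light_bishop_graph_def dark_bishop_graph_def dominates_induce_subgraph_iff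
    with_proj_simps parcs_bishop_graph_iff by blast+

lemma graph_bishop_graphs: "graph (light_bishop_graph a b)" "graph (dark_bishop_graph a b)"
proof -
  interpret pair_graph "bishop_graph a b" by (rule pair_graph_bishop_graph)
  have "graph (with_proj (bishop_graph a b))" by unfold_locales
  note graph_induce_subgraph[OF this, unfolded with_proj_simps pverts_bishop_graph]
  then show "graph (light_bishop_graph a b)" "graph (dark_bishop_graph a b)"
    unfolding light_bishop_graph_def dark_bishop_graph_def
    by (simp_all only: bishop_squares_subset)
qed

text \<open>An executable form of the two colour classes, from which the explicit lists for fixed
  boards are computed.\<close>

lemma bishop_squares_eq_set:
  "light_squares a b = set (filter (\<lambda>(i, j). even (i + j)) (List.product [1..<Suc a] [1..<Suc b]))"
  "dark_squares a b = set (filter (\<lambda>(i, j). odd (i + j)) (List.product [1..<Suc a] [1..<Suc b]))"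
  unfolding light_squares_def dark_squares_def by auto

section \<open>The metric dimension of the game graph from data on its factors\<close>

lemma graph_two_bishop_game_graph: "graph (with_proj (two_bishop_game_graph a b))"
proof -
  interpret pair_graph "two_bishop_game_graph a b" by (rule pair_graph_two_bishop_game_graph)
  show ?thesis by unfold_locales
qed

text \<open>Degrees of at least \<open>m\<close> in both factors give degrees of at least
  \<open>2 * m\<close> in the product, so \<open>3 ^ k < 2 * m\<close> rules out
  \<open>k + 1\<close> or fewer landmarks, while \<open>S\<close> resolves with
  \<open>k + 2\<close>.\<close>

lemma metric_dimension_two_bishop_game_graph_eqI:
  assumes D: "graph_metric (light_bishop_graph a b) D" "graph_metric (dark_bishop_graph a b) D"
    and deg: "\<And>u. u \<in> light_squares a b \<Longrightarrow> m \<le> card {v. u \<rightarrow>\<^bsub>light_bishop_graph a b\<^esub> v}"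
      "\<And>u. u \<in> dark_squares a b \<Longrightarrow> m \<le> card {v. u \<rightarrow>\<^bsub>dark_bishop_graph a b\<^esub> v}"
    and m: "3 ^ k < 2 * m"
    and S: "distinct S" "set S \<subseteq> light_squares a b \<times> dark_squares a b" "length S = k + 2"
    and inj: "inj_on (\<lambda>v. map (\<lambda>u. D (fst u) (fst v) + D (snd u) (snd v)) S)
      (light_squares a b \<times> dark_squares a b)"
  shows "metric_dimension (with_proj (two_bishop_game_graph a b)) = k + 2"
proof -
  let ?G = "with_proj (two_bishop_game_graph a b)"
  let ?D = "\<lambda>u v. D (fst u) (fst v) + D (snd u) (snd v)"
  interpret graph ?G by (rule graph_two_bishop_game_graph)
  have V: "verts ?G = light_squares a b \<times> dark_squares a b"
    by (simp only: two_bishop_game_graph_def verts_cartesian_product verts_bishop_graphs)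
  have metric: "graph_metric ?G ?D"
    unfolding two_bishop_game_graph_def by (rule graph_metric_cartesian_product[OF D])
  show ?thesis
  proof (rule metric_dimension_eqI)
    show "resolving_set ?G S"
      using S inj by (simp only: resolving_set_iff_inj_on[OF metric] V)
    show "length S = k + 2" by fact
  next
    fix T assume T: "resolving_set ?G T"
    show "k + 2 \<le> length T"
    proof (rule length_resolving_set_ge[OF metric T])
      show "verts ?G \<noteq> {}" using S unfolding V by (cases S) auto
    next
      fix p assume "p \<in> verts ?G"
      then obtain u x where p: "p = (u, x)" "u \<in> light_squares a b" "x \<in> dark_squares a b"
        unfolding V by blast
      then have "card {w. p \<rightarrow>\<^bsub>?G\<^esub> w} =
          card {v. u \<rightarrow>\<^bsub>light_bishop_graph a b\<^esub> v} + card {y. x \<rightarrow>\<^bsub>dark_bishop_graph a b\<^esub> y}"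
        unfolding two_bishop_game_graph_def
        using card_neighbours_cartesian_product[OF graph_bishop_graphs]
        by (simp only: verts_bishop_graphs)
      with deg(1)[OF p(2)] deg(2)[OF p(3)] m show "3 ^ k < card {w. p \<rightarrow>\<^bsub>?G\<^esub> w}" by linarith
    qed
  qed
qed

subsection \<open>Two rows\<close>

text \<open>One of the two truncated differences is 0, so this is the absolute difference of the
  columns. On two rows the colour and the column fix the row.\<close>

definition column_dist :: "nat \<times> nat \<Rightarrow> nat \<times> nat \<Rightarrow> nat" where
  "column_dist u v = (snd u - snd v) + (snd v - snd u)"

text \<open>Rows 1 and 2 have opposite parity, so a colour class has a single square in each column.
  This is what makes it a path.\<close>

lemma two_row_column_unique:
  fixes i i' j :: nat
  assumes "i \<in> {1..2}" "i' \<in> {1..2}" "even (i + j) \<longleftrightarrow> even (i' + j)"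
  shows "i = i'"
proof -
  have "i = 1 \<or> i = 2" "i' = 1 \<or> i' = 2" using assms by auto
  with assms(3) show ?thesis by auto
qed

text \<open>The term \<open>3 - i\<close> exchanges rows 1 and 2, which offsets the change of parity
  caused by moving one column. The truth value \<open>c\<close> selects the colour.\<close>

lemma two_row_step:
  assumes V: "verts G = {(i, j) \<in> {1..2} \<times> {1..n}. even (i + j) \<longleftrightarrow> c}"
    and adj: "\<And>u v. u \<rightarrow>\<^bsub>G\<^esub> v \<longleftrightarrow> u \<in> verts G \<and> v \<in> verts G \<and> bishop_move u v"
    and u: "(i, j) \<in> verts G" and k: "k \<in> {1..n}" "k = Suc j \<or> j = Suc k"
  shows "(i, j) \<rightarrow>\<^bsub>G\<^esub> (3 - i, k)"
proof -
  have "i = 1 \<or> i = 2" using u by (auto simp: V)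
  then have "even (3 - i + k) \<longleftrightarrow> even (i + j)" "bishop_move (i, j) (3 - i, k)" "3 - i \<in> {1..2}"
    using k(2) by (auto simp: bishop_move_def)
  then show ?thesis using u k(1) unfolding adj by (simp add: V)
qed

lemma graph_metric_two_rows:
  assumes V: "verts G = {(i, j) \<in> {1..2} \<times> {1..n}. even (i + j) \<longleftrightarrow> c}"
    and adj: "\<And>u v. u \<rightarrow>\<^bsub>G\<^esub> v \<longleftrightarrow> u \<in> verts G \<and> v \<in> verts G \<and> bishop_move u v"
  shows "graph_metric G column_dist"
  unfolding graph_metric_def
proof (intro conjI ballI allI impI)
  fix u w v assume "u \<rightarrow>\<^bsub>G\<^esub> w"
  show "column_dist u v \<le> Suc (column_dist w v)"
  proof -
    have "verts G \<subseteq> {1..2} \<times> {1..n}" unfolding V by blast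
    then have "u \<in> {1..2} \<times> {1..n}" "w \<in> {1..2} \<times> {1..n}"
      using \<open>u \<rightarrow>\<^bsub>G\<^esub> w\<close> adj by blast+
    then have "1 \<le> fst u" "fst u \<le> 2" "1 \<le> fst w" "fst w \<le> 2" by (simp_all add: mem_Times_iff)
    moreover have "\<bar>int (fst u) - int (fst w)\<bar> = \<bar>int (snd u) - int (snd w)\<bar>"
      using \<open>u \<rightarrow>\<^bsub>G\<^esub> w\<close> unfolding adj bishop_move_iff by blast
    \<comment> \<open>With two rows a diagonal move spans at most one row, hence at most one
      column.\<close>
    ultimately have "\<bar>int (snd u) - int (snd w)\<bar> \<le> 1" by linarith
    then show ?thesis unfolding column_dist_def by linarith
  qed
next
  fix u v assume u: "u \<in> verts G" and v: "v \<in> verts G" and "u \<noteq> v"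
  obtain i j i' j' where ij: "u = (i, j)" "v = (i', j')" by fastforce
  have "j \<noteq> j'"
  proof
    assume "j = j'"
    then have "i = i'" using u v ij two_row_column_unique[of i i' j] by (auto simp: V)
    with \<open>j = j'\<close> \<open>u \<noteq> v\<close> ij show False by simp
  qed
  \<comment> \<open>The next column from \<open>j\<close> towards \<open>j'\<close>; it stays on the
    board because \<open>j'\<close> does.\<close>
  define k where "k = (if j < j' then Suc j else j - 1)"
  have "j \<in> {1..n}" "j' \<in> {1..n}" using u v by (simp_all add: V ij)
  with \<open>j \<noteq> j'\<close> have k: "k \<in> {1..n}" "k = Suc j \<or> j = Suc k"
    and dist: "(j - j') + (j' - j) = Suc ((k - j') + (j' - k))"
    by (cases "j < j'"; simp add: k_def; linarith)+
  have "u \<rightarrow>\<^bsub>G\<^esub> (3 - i, k)"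
    using two_row_step[OF V adj _ k] u ij by simp
  moreover have "column_dist u v = Suc (column_dist (3 - i, k) v)"
    using dist by (simp add: ij column_dist_def)
  ultimately show "\<exists>w. u \<rightarrow>\<^bsub>G\<^esub> w \<and> column_dist u v = Suc (column_dist w v)" by blast
qed (auto simp: column_dist_def)

lemma card_neighbours_two_rows:
  assumes V: "verts G = {(i, j) \<in> {1..2} \<times> {1..n}. even (i + j) \<longleftrightarrow> c}"
    and adj: "\<And>u v. u \<rightarrow>\<^bsub>G\<^esub> v \<longleftrightarrow> u \<in> verts G \<and> v \<in> verts G \<and> bishop_move u v"
    and u: "u \<in> verts G" and n: "n > 1"
  shows "1 \<le> card {v. u \<rightarrow>\<^bsub>G\<^esub> v}"
proof -
  obtain i j where ij: "u = (i, j)" by fastforce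
  \<comment> \<open>The column to the right, or to the left of the last column, which exists since
    \<open>n > 1\<close>.\<close>
  define k where "k = (if j < n then Suc j else j - 1)"
  have "j \<in> {1..n}" using u by (simp add: V ij)
  with n have k: "k \<in> {1..n}" "k = Suc j \<or> j = Suc k" by (auto simp: k_def)
  have "u \<rightarrow>\<^bsub>G\<^esub> (3 - i, k)"
    using two_row_step[OF V adj _ k] u ij by simp
  \<comment> \<open>An infinite set would have \<open>card\<close> equal to 0, so a neighbour alone
    does not give a positive count.\<close>
  moreover have "finite (verts G)"
    unfolding V by (rule finite_subset[of _ "{1..2} \<times> {1..n}"]) auto
  then have "finite {v. u \<rightarrow>\<^bsub>G\<^esub> v}"
    by (rule rev_finite_subset) (auto simp: adj)
  ultimately have "card {v. u \<rightarrow>\<^bsub>G\<^esub> v} \<noteq> 0" by auto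
  then show ?thesis by simp
qed

text \<open>The landmarks share an end of the light path and use both ends of the dark path. For
  bishops in columns \<open>j\<close> and \<open>l\<close> the two distances determine
  \<open>j + l\<close> and \<open>j - l\<close>, hence both columns.\<close>

lemma metric_dimension_two_rows:
  assumes n: "n > 1"
  shows "metric_dimension (with_proj (two_bishop_game_graph 2 n)) = 2"
proof -
  \<comment> \<open>The row whose square in the last column is dark.\<close>
  define c where "c = (if even n then 1 else 2 :: nat)"
  define S :: "((nat \<times> nat) \<times> (nat \<times> nat)) list"
    where "S = [((1, 1), (2, 1)), ((1, 1), (c, n))]"
  let ?V = "light_squares 2 n \<times> dark_squares 2 n"
  have L: "verts (light_bishop_graph 2 n) = {(i, j) \<in> {1..2} \<times> {1..n}. even (i + j) \<longleftrightarrow> True}"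
    and K: "verts (dark_bishop_graph 2 n) = {(i, j) \<in> {1..2} \<times> {1..n}. even (i + j) \<longleftrightarrow> False}"
    by (simp_all add: verts_bishop_graphs light_squares_def dark_squares_def)
  have adjL: "u \<rightarrow>\<^bsub>light_bishop_graph 2 n\<^esub> v \<longleftrightarrow>
      u \<in> verts (light_bishop_graph 2 n) \<and> v \<in> verts (light_bishop_graph 2 n) \<and> bishop_move u v"
    and adjK: "u \<rightarrow>\<^bsub>dark_bishop_graph 2 n\<^esub> v \<longleftrightarrow>
      u \<in> verts (dark_bishop_graph 2 n) \<and> v \<in> verts (dark_bishop_graph 2 n) \<and> bishop_move u v" for u v
    by (simp_all add: dominates_bishop_graphs_iff verts_bishop_graphs)
  have "metric_dimension (with_proj (two_bishop_game_graph 2 n)) = 0 + 2"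
  proof (rule metric_dimension_two_bishop_game_graph_eqI)
    show "graph_metric (light_bishop_graph 2 n) column_dist"
      by (rule graph_metric_two_rows[OF L adjL])
    show "graph_metric (dark_bishop_graph 2 n) column_dist"
      by (rule graph_metric_two_rows[OF K adjK])
    show "1 \<le> card {v. u \<rightarrow>\<^bsub>light_bishop_graph 2 n\<^esub> v}" if "u \<in> light_squares 2 n" for u
      by (rule card_neighbours_two_rows[OF L adjL _ n]) (simp add: that verts_bishop_graphs)
    show "1 \<le> card {v. u \<rightarrow>\<^bsub>dark_bishop_graph 2 n\<^esub> v}" if "u \<in> dark_squares 2 n" for u
      by (rule card_neighbours_two_rows[OF K adjK _ n]) (simp add: that verts_bishop_graphs)
    show "(3::nat) ^ 0 < 2 * 1" by simp
    show "distinct S" "length S = 0 + 2" using n by (auto simp: S_def)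
    show "set S \<subseteq> ?V"
      using n by (auto simp: S_def c_def light_squares_def dark_squares_def)
    show "inj_on (\<lambda>v. map (\<lambda>u. column_dist (fst u) (fst v) + column_dist (snd u) (snd v)) S) ?V"
    proof (rule inj_onI)
      fix p q assume p: "p \<in> ?V" and q: "q \<in> ?V"
        and eq: "map (\<lambda>u. column_dist (fst u) (fst p) + column_dist (snd u) (snd p)) S =
          map (\<lambda>u. column_dist (fst u) (fst q) + column_dist (snd u) (snd q)) S"
      obtain i j k l i' j' k' l' where [simp]: "p = ((i, j), (k, l))" "q = ((i', j'), (k', l'))"
        by (metis surj_pair)
      have j: "1 \<le> j" "1 \<le> j'" and l: "1 \<le> l" "1 \<le> l'" "l \<le> n" "l' \<le> n"
        using p q by (auto simp: light_squares_def dark_squares_def)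
      from eq j l have "(j - 1) + (l - 1) = (j' - 1) + (l' - 1)"
        by (simp add: S_def column_dist_def)
      with j l(1,2) have "j + l = j' + l'" by linarith
      moreover from eq j l have "(j - 1) + (n - l) = (j' - 1) + (n - l')"
        by (simp add: S_def column_dist_def)
      with j l(3,4) have "j + l' = j' + l" by linarith
      ultimately have [simp]: "j = j'" "l = l'" by linarith+
      have "i = i'" "k = k'"
        using p q two_row_column_unique[of i i' j'] two_row_column_unique[of k k' l']
        by (auto simp: light_squares_def dark_squares_def)
      then show "p = q" by simp
    qed
  qed
  then show ?thesis by simp
qed

subsection \<open>Three rows\<close>

text \<open>The decreasing arc leads to \<open>v\<close> itself if \<open>v\<close> is adjacent to
  \<open>u\<close>, and to a common neighbour otherwise.\<close>

lemma graph_metric_bishop_dist: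
  assumes V: "verts G = set L"
    and adj: "\<And>u v. u \<rightarrow>\<^bsub>G\<^esub> v \<longleftrightarrow> u \<in> set L \<and> v \<in> set L \<and> bishop_move u v"
    and L: "diameter_two L"
  shows "graph_metric G bishop_dist"
  unfolding graph_metric_def V
proof (intro conjI ballI allI impI)
  fix u v assume "u \<in> set L" "v \<in> set L" "u \<noteq> v"
  then obtain w where "w \<in> set L" "bishop_move u w" "w = v \<or> \<not> bishop_move u v \<and> bishop_move w v"
    using L unfolding diameter_two_def by metis
  moreover from this have "bishop_dist u v = Suc (bishop_dist w v)"
    using \<open>u \<noteq> v\<close> by (auto simp: bishop_dist_def bishop_move_def)
  ultimately show "\<exists>w. u \<rightarrow>\<^bsub>G\<^esub> w \<and> bishop_dist u v = Suc (bishop_dist w v)"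
    using \<open>u \<in> set L\<close> unfolding adj by blast
qed (auto simp: adj bishop_dist_def bishop_move_sym)

lemma card_neighbours_ge_two:
  assumes adj: "\<And>u v. u \<rightarrow>\<^bsub>G\<^esub> v \<longleftrightarrow> u \<in> set L \<and> v \<in> set L \<and> bishop_move u v"
    and L: "min_degree_two L" and u: "u \<in> set L"
  shows "2 \<le> card {v. u \<rightarrow>\<^bsub>G\<^esub> v}"
proof -
  obtain v w where vw: "v \<in> set L" "w \<in> set L" "v \<noteq> w" "bishop_move u v" "bishop_move u w"
    using L u unfolding min_degree_two_def by blast
  have "card {v, w} \<le> card {v. u \<rightarrow>\<^bsub>G\<^esub> v}"
    using vw u by (intro card_mono) (auto simp: adj)
  with vw show ?thesis by simp
qed

text \<open>Leaves only finite checks on explicit lists of squares, all of which can be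
  evaluated.\<close>

lemma metric_dimension_eq_3I:
  assumes V: "light_squares a b = set L" "dark_squares a b = set K"
    and LK: "diameter_two L" "diameter_two K" "min_degree_two L" "min_degree_two K"
    and S: "distinct S" "set S \<subseteq> set (List.product L K)" "length S = 3"
    and distinct: "distinct (map (\<lambda>v. map (\<lambda>u. bishop_dist (fst u) (fst v) + bishop_dist (snd u) (snd v)) S)
      (List.product L K))"
  shows "metric_dimension (with_proj (two_bishop_game_graph a b)) = 3"
proof -
  note adj = dominates_bishop_graphs_iff[where a = a and b = b, unfolded V]
  note verts = verts_bishop_graphs[where a = a and b = b, unfolded V]
  have "metric_dimension (with_proj (two_bishop_game_graph a b)) = 1 + 2"
  proof (rule metric_dimension_two_bishop_game_graph_eqI)
    show "graph_metric (light_bishop_graph a b) bishop_dist"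
      by (rule graph_metric_bishop_dist[OF verts(1) adj(1) LK(1)])
    show "graph_metric (dark_bishop_graph a b) bishop_dist"
      by (rule graph_metric_bishop_dist[OF verts(2) adj(2) LK(2)])
    show "2 \<le> card {v. u \<rightarrow>\<^bsub>light_bishop_graph a b\<^esub> v}" if "u \<in> light_squares a b" for u
      using that unfolding V by (rule card_neighbours_ge_two[OF adj(1) LK(3)])
    show "2 \<le> card {v. u \<rightarrow>\<^bsub>dark_bishop_graph a b\<^esub> v}" if "u \<in> dark_squares a b" for u
      using that unfolding V by (rule card_neighbours_ge_two[OF adj(2) LK(4)])
    \<comment> \<open>Two landmarks would allow at most three neighbours, but every vertex has at
      least four.\<close>
    show "(3::nat) ^ 1 < 2 * 2" by simp
    show "distinct S" "set S \<subseteq> light_squares a b \<times> dark_squares a b" "length S = 1 + 2"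
      using S by (simp_all add: V)
    show "inj_on (\<lambda>v. map (\<lambda>u. bishop_dist (fst u) (fst v) + bishop_dist (snd u) (snd v)) S)
        (light_squares a b \<times> dark_squares a b)"
      using distinct by (simp add: V distinct_map)
  qed
  then show ?thesis by simp
qed

lemma bishop_squares_3_3:
  "light_squares 3 3 = set [(1, 1), (1, 3), (2, 2), (3, 1), (3, 3)]"
  "dark_squares 3 3 = set [(1, 2), (2, 1), (2, 3), (3, 2)]"
  unfolding bishop_squares_eq_set by code_simp+

lemma bishop_squares_3_4:
  "light_squares 3 4 = set [(1, 1), (1, 3), (2, 2), (2, 4), (3, 1), (3, 3)]"
  "dark_squares 3 4 = set [(1, 2), (1, 4), (2, 1), (2, 3), (3, 2), (3, 4)]"
  unfolding bishop_squares_eq_set by code_simp+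

lemma metric_dimension_3_3: "metric_dimension (with_proj (two_bishop_game_graph 3 3)) = 3"
  by (rule metric_dimension_eq_3I[OF bishop_squares_3_3 diameter_two_3_3 min_degree_two_3_3 _ _ _ bishop_dist_3_3])
    auto

lemma metric_dimension_3_4: "metric_dimension (with_proj (two_bishop_game_graph 3 4)) = 3"
  by (rule metric_dimension_eq_3I[OF bishop_squares_3_4 diameter_two_3_4 min_degree_two_3_4 _ _ _ bishop_dist_3_4])
    auto

theorem theorem5p2:
  shows "(\<forall>n::nat. n > 1 \<longrightarrow> metric_dimension (with_proj (two_bishop_game_graph 2 n)) = 2) \<and>
         metric_dimension (with_proj (two_bishop_game_graph 3 3)) = 3 \<and>
         metric_dimension (with_proj (two_bishop_game_graph 3 4)) = 3"
  using metric_dimension_two_rows metric_dimension_3_3 metric_dimension_3_4 by blast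

end
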